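(* Let $l,r\ge 0$ be integers and let $S$ be the $(p,m,2)$ signed graph consisting of a positive edge $z_1z_2$, to which are attached $l$ positive pendant edges $z_1v_i$ ($1\le i\le l$) and $2$ negative pendant edges $z_1u_1,z_1u_2$ at one end as well as $r$ positive pendant edges $z_2w_i$ ($1\le i\le r$) at the other end. If $l,r\geq 2$ and $l$ is even then $S$ is additively graceful. Further, if $r=2$ or $r=3$ then, for each $l\geq 2$ with $l\equiv 0\pmod 2$, the additively graceful labeling of $S$ is unique up to rearrangement of labels among the $u_i$'s, among the $v_i$'s and among the $w_i$'s.
   Context: A signed graph $S$ is a finite simple graph on $p$ vertices in which $m$ edges are specified as positive and the remaining $n$ edges are specified as negative; it is then called a $(p,m,n)$ signed graph, with sets of positive and negative edges $E^+(S)$ and $E^-(S)$. Attaching a pendant edge at a vertex $z$ means adding a new vertex of degree 1 joined to $z$; all the named vertices of $S$ are distinct and $S$ has no other vertices or edges. An additively graceful labeling of a $(p,m,n)$ signed graph $S=(V,E)$ is an injective map $f:V\to\{0,1,\dots,m+\lceil\frac{n+1}{2}\rceil\}$ such that, with $f^*(uv)=f(u)+f(v)$ for $uv\in E^-(S)$ and $f^*(uv)=|f(u)-f(v)|$ for $uv\in E^+(S)$, one has $\{f^*(uv):uv\in E^-(S)\}=\{1,2,\dots,n\}$ and $\{f^*(uv):uv\in E^+(S)\}=\{1,2,\dots,m\}$. $S$ is additively graceful if it admits such a labeling. *)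

theory Defs
  imports Complex_Main "HOL-Combinatorics.Permutations"
begin

record 'a signed_graph =
  verts :: "'a set"
  pos_edges :: "'a set set"
  neg_edges :: "'a set set"

definition signed_graph :: "'a signed_graph \<Rightarrow> nat \<Rightarrow> nat \<Rightarrow> nat \<Rightarrow> bool" where
  "signed_graph S p m n \<longleftrightarrow>
     finite (verts S) \<and>
     (\<forall>e \<in> pos_edges S \<union> neg_edges S. e \<subseteq> verts S \<and> card e = 2) \<and>
     pos_edges S \<inter> neg_edges S = {} \<and>
     card (verts S) = p \<and> card (pos_edges S) = m \<and> card (neg_edges S) = n"

text \<open>Labelings are total integer-valued functions; only their values on \<^term>\<open>verts S\<close>
  matter.\<close>

definition additively_graceful_labeling :: "'a signed_graph \<Rightarrow> ('a \<Rightarrow> int) \<Rightarrow> bool" where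
  "additively_graceful_labeling S f \<longleftrightarrow>
     (\<exists>p m n. signed_graph S p m n \<and>
        inj_on f (verts S) \<and>
        f ` verts S \<subseteq> {0 .. int m + \<lceil>(real n + 1) / 2\<rceil>} \<and>
        {f x + f y | x y. {x, y} \<in> neg_edges S} = {1 .. int n} \<and>
        {\<bar>f x - f y\<bar> | x y. {x, y} \<in> pos_edges S} = {1 .. int m})"

definition additively_graceful :: "'a signed_graph \<Rightarrow> bool" where
  "additively_graceful S \<longleftrightarrow> (\<exists>f. additively_graceful_labeling S f)"

definition pendant_graph ::
  "'a \<Rightarrow> 'a \<Rightarrow> (nat \<Rightarrow> 'a) \<Rightarrow> (nat \<Rightarrow> 'a) \<Rightarrow> (nat \<Rightarrow> 'a) \<Rightarrow> nat \<Rightarrow> nat \<Rightarrow> 'a signed_graph" where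
  "pendant_graph z1 z2 u v w l r =
     \<lparr> verts = {z1, z2} \<union> u ` {1..2} \<union> v ` {1..l} \<union> w ` {1..r},
       pos_edges = {{z1, z2}} \<union> {{z1, v i} | i. i \<in> {1..l}} \<union> {{z2, w i} | i. i \<in> {1..r}},
       neg_edges = {{z1, u i} | i. i \<in> {1..2}} \<rparr>"

definition named_vertices_distinct ::
  "'a \<Rightarrow> 'a \<Rightarrow> (nat \<Rightarrow> 'a) \<Rightarrow> (nat \<Rightarrow> 'a) \<Rightarrow> (nat \<Rightarrow> 'a) \<Rightarrow> nat \<Rightarrow> nat \<Rightarrow> bool" where
  "named_vertices_distinct z1 z2 u v w l r \<longleftrightarrow>
     distinct ([z1, z2] @ map u [1..<Suc 2] @ map v [1..<Suc l] @ map w [1..<Suc r])"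

lemma named_vertices_distinct_iff:
  "named_vertices_distinct z1 z2 u v w l r \<longleftrightarrow>
     z1 \<noteq> z2 \<and> inj_on u {1..2} \<and> inj_on v {1..l} \<and> inj_on w {1..r} \<and>
     {z1, z2} \<inter> (u ` {1..2} \<union> v ` {1..l} \<union> w ` {1..r}) = {} \<and>
     u ` {1..2} \<inter> (v ` {1..l} \<union> w ` {1..r}) = {} \<and> v ` {1..l} \<inter> w ` {1..r} = {}"
proof -
  have *: "distinct ([z1, z2] @ map u us @ map v vs @ map w ws) \<longleftrightarrow>
     z1 \<noteq> z2 \<and> inj_on u (set us) \<and> inj_on v (set vs) \<and> inj_on w (set ws) \<and>
     {z1, z2} \<inter> (u ` set us \<union> v ` set vs \<union> w ` set ws) = {} \<and>
     u ` set us \<inter> (v ` set vs \<union> w ` set ws) = {} \<and> v ` set vs \<inter> w ` set ws = {}"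
    if "distinct us" "distinct vs" "distinct ws" for us vs ws :: "nat list"
  proof -
    have "set [z1, z2] = {z1, z2}" "distinct [z1, z2] \<longleftrightarrow> z1 \<noteq> z2" by auto
    then show ?thesis
      by (simp only: distinct_append distinct_map set_append set_map that Int_Un_distrib Un_assoc
          Un_empty simp_thms) argo
  qed
  show ?thesis
    unfolding named_vertices_distinct_def *[OF distinct_upt distinct_upt distinct_upt] set_upt
      atLeastLessThanSuc_atLeastAtMost ..
qed

lemma signed_graph_pendant_graph:
  assumes "named_vertices_distinct z1 z2 u v w l r"
  shows "signed_graph (pendant_graph z1 z2 u v w l r) (l + r + 4) (l + r + 1) 2"
proof -
  define U V W where "U = u ` {1..2}" and "V = v ` {1..l}" and "W = w ` {1..r}"
  define A B N where "A = (\<lambda>x. {z1, x}) ` insert z2 V" and "B = (\<lambda>x. {z2, x}) ` W"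
    and "N = (\<lambda>x. {z1, x}) ` U"
  have z: "z1 \<noteq> z2" "z1 \<notin> U" "z1 \<notin> V" "z1 \<notin> W" "z2 \<notin> U" "z2 \<notin> V" "z2 \<notin> W"
    and disj: "U \<inter> V = {}" "U \<inter> W = {}" "V \<inter> W = {}"
    and c: "card U = 2" "card V = l" "card W = r"
    using assms unfolding named_vertices_distinct_iff U_def V_def W_def
    by (auto simp: card_image)
  have fin: "finite U" "finite V" "finite W" by (simp_all add: U_def V_def W_def)
  have P: "pos_edges (pendant_graph z1 z2 u v w l r) = A \<union> B"
    and E: "neg_edges (pendant_graph z1 z2 u v w l r) = N"
    and Vs: "verts (pendant_graph z1 z2 u v w l r) = insert z1 (insert z2 (U \<union> (V \<union> W)))"
    unfolding pendant_graph_def A_def B_def N_def U_def V_def W_def by auto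
  have inj: "inj_on (\<lambda>x. {z, x}) X" for z :: 'a and X
    by (auto simp: inj_on_def doubleton_eq_iff)
  have AB: "A \<inter> B = {}" and PN: "(A \<union> B) \<inter> N = {}"
    using z disj by (auto simp: A_def B_def N_def doubleton_eq_iff)
  have cA: "card A = l + 1" and cB: "card B = r" and cN: "card N = 2"
    unfolding A_def B_def N_def card_image[OF inj] using z c fin by simp_all
  have "finite A" "finite B" using fin by (simp_all add: A_def B_def)
  then have cP: "card (A \<union> B) = l + r + 1"
    using card_Un_disjoint[OF _ _ AB] cA cB by simp
  have "card (V \<union> W) = l + r"
    using card_Un_disjoint[OF fin(2,3) disj(3)] c by simp
  moreover have "U \<inter> (V \<union> W) = {}" using disj by blast
  ultimately have "card (U \<union> (V \<union> W)) = l + r + 2"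
    using card_Un_disjoint[of U "V \<union> W"] fin c by simp
  then have cV: "card (insert z1 (insert z2 (U \<union> (V \<union> W)))) = l + r + 4"
    using z fin by simp
  have ed: "\<forall>e \<in> (A \<union> B) \<union> N. e \<subseteq> insert z1 (insert z2 (U \<union> (V \<union> W))) \<and> card e = 2"
    using z by (auto simp: A_def B_def N_def card_insert_if)
  show ?thesis
    unfolding signed_graph_def P E Vs using cP cN cV ed PN fin by simp
qed

text \<open>Equality of labelings up to permuting the values among the \<open>u i\<close>, among the
  \<open>v i\<close> and among the \<open>w i\<close>.\<close>

definition equal_up_to_rearrangement ::
  "'a \<Rightarrow> 'a \<Rightarrow> (nat \<Rightarrow> 'a) \<Rightarrow> (nat \<Rightarrow> 'a) \<Rightarrow> (nat \<Rightarrow> 'a) \<Rightarrow> nat \<Rightarrow> nat \<Rightarrow>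
     ('a \<Rightarrow> int) \<Rightarrow> ('a \<Rightarrow> int) \<Rightarrow> bool" where
  "equal_up_to_rearrangement z1 z2 u v w l r f g \<longleftrightarrow>
     g z1 = f z1 \<and> g z2 = f z2 \<and>
     (\<exists>\<alpha> \<beta> \<gamma>. \<alpha> permutes {1..2} \<and> \<beta> permutes {1..l} \<and> \<gamma> permutes {1..r} \<and>
        (\<forall>i \<in> {1..2}. g (u i) = f (u (\<alpha> i))) \<and>
        (\<forall>i \<in> {1..l}. g (v i) = f (v (\<beta> i))) \<and>
        (\<forall>i \<in> {1..r}. g (w i) = f (w (\<gamma> i))))"

end

theory Submission
  imports Defs
begin

text \<open>
  Put \<open>m = l + r + 1\<close>. There are as many vertices as available labels \<open>0, ..., m + 2\<close>, so a
  labeling uses each of them exactly once. Negative sums \<open>1\<close> and \<open>2\<close> force the label \<open>0\<close> at \<open>z1\<close>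
  and the labels \<open>1, 2\<close> at the \<open>u i\<close>. What remains is a question about sets of integers
  (\<open>graceful_iff_label_sets\<close>): with \<open>a\<close> the label of \<open>z2\<close>, and \<open>X\<close>, \<open>Y\<close> the label sets of the
  \<open>v i\<close> and the \<open>w i\<close>, both \<open>{a} \<union> X \<union> Y = {3..m+2}\<close> and
  \<open>{a} \<union> X \<union> {\<bar>a - y\<bar> | y \<in> Y} = {1..m}\<close> must hold. Comparing the two equations,
  \<open>Y\<close> contains \<open>m + 1, m + 2\<close>, and \<open>y \<mapsto> \<bar>a - y\<bar>\<close> maps \<open>Y\<close> onto the set obtained from \<open>Y\<close> by
  replacing these two labels by \<open>1, 2\<close>.

  Existence (\<open>label_sets_exist\<close>): for \<open>a = m\<close> the labels \<open>m + 1, m + 2\<close> are sent to \<open>1, 2\<close>, so it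
  is enough that the rest of \<open>Y\<close> is invariant under \<open>y \<mapsto> m - y\<close>. When \<open>l\<close> is even,
  an interval of \<open>r - 2\<close> integers centred at \<open>m / 2\<close> qualifies.

  Uniqueness (\<open>label_sets_unique_2\<close>, \<open>label_sets_unique_3\<close>): for \<open>r = 2\<close> or \<open>r = 3\<close> at most one label in \<open>Y\<close>
  differs from \<open>m + 1\<close> and \<open>m + 2\<close>, and a short case analysis determines \<open>a\<close> and \<open>Y\<close>, hence
  also \<open>X\<close>. Injective labelings with the same label sets differ by permutations of the indices
  (\<open>same_image_imp_permuted\<close>).
\<close>

section \<open>Stars and rearrangements\<close>

text \<open>All edges of the graph lie in stars centred at \<open>z1\<close> and \<open>z2\<close>. An edge is an unordered pair,
  so each value is read off in both orders; symmetry of \<open>h\<close> makes the two readings agree.\<close>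

lemma star_values:
  assumes "\<And>x y. h x y = h y x"
  shows "{h x y | x y. {x, y} \<in> (\<lambda>x. {z, x}) ` A} = h z ` A"
  using assms by (fastforce simp: doubleton_eq_iff)

lemma same_image_imp_permuted:
  assumes F: "inj_on F A" and G: "inj_on G A" and im: "F ` A = G ` A"
  shows "\<exists>\<pi>. \<pi> permutes A \<and> (\<forall>i\<in>A. G i = F (\<pi> i))"
proof -
  define \<pi> where "\<pi> = (\<lambda>i. if i \<in> A then inv_into A F (G i) else i)"
  have "bij_betw (inv_into A F \<circ> G) A A"
    using bij_betw_trans[of G A "G ` A" "inv_into A F" A] inj_on_imp_bij_betw[OF G]
      bij_betw_inv_into[OF inj_on_imp_bij_betw[OF F]] im by simp
  then have "bij_betw \<pi> A A"
    by (rule bij_betw_cong[THEN iffD1, rotated]) (simp add: \<pi>_def)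
  then have "\<pi> permutes A"
    by (rule bij_imp_permutes) (simp add: \<pi>_def)
  moreover have "\<forall>i\<in>A. G i = F (\<pi> i)"
    using im by (auto simp: \<pi>_def f_inv_into_f)
  ultimately show ?thesis by blast
qed

section \<open>Reduction to sets of labels\<close>

text \<open>The set \<open>{1, 2}\<close> of negative values leaves no choice at \<open>z1\<close>: the labels are nonnegative, and
  the label \<open>1\<close> at \<open>z1\<close> would make some \<open>u i\<close> repeat it.\<close>

lemma negative_sums_determine_labels:
  fixes c :: int
  assumes "(\<lambda>x. c + x) ` B = {1..2}" and "c \<ge> 0" and "\<And>x. x \<in> B \<Longrightarrow> x \<ge> 0" and "c \<notin> B"
  shows "c = 0 \<and> B = {1, 2}"
proof -
  have B: "B = (\<lambda>x. x - c) ` {1..2}"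
    unfolding assms(1)[symmetric] image_image by simp
  have two: "{1..2::int} = {1, 2}" by auto
  have "1 - c \<in> B" "2 - c \<in> B" by (auto simp: B)
  then have "c = 0" using assms(2-4) by (smt (verit, best))
  then show ?thesis using B two by simp
qed

text \<open>The right-hand side encodes injectivity of the labeling: together with the labels of \<open>z1\<close>
  and the \<open>u i\<close>, its first set equation makes \<open>f\<close> surjective onto a set of the same size as the
  vertex set. Conversely, injectivity and the range condition make a labeling surjective. As
  \<open>f z1 = 0\<close>, the value of a positive edge at \<open>z1\<close> is the label of its other end.\<close>

lemma graceful_iff_label_sets:
  assumes "named_vertices_distinct z1 z2 u v w l r"
  shows "additively_graceful_labeling (pendant_graph z1 z2 u v w l r) f \<longleftrightarrow>
    f z1 = 0 \<and> f ` u ` {1..2} = {1, 2} \<and>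
    insert (f z2) (f ` v ` {1..l} \<union> f ` w ` {1..r}) = {3..int (l + r + 1) + 2} \<and>
    insert (f z2) (f ` v ` {1..l} \<union> (\<lambda>y. \<bar>f z2 - y\<bar>) ` f ` w ` {1..r}) = {1..int (l + r + 1)}"
    (is "?L \<longleftrightarrow> ?R")
proof -
  define S where "S = pendant_graph z1 z2 u v w l r"
  define m where "m = l + r + 1"
  define U V W where "U = u ` {1..2::nat}" and "V = v ` {1..l}" and "W = w ` {1..r}"
  have sg: "signed_graph S (l + r + 4) m 2"
    using signed_graph_pendant_graph[OF assms] by (simp add: S_def m_def)
  have Vs: "verts S = insert z1 (insert z2 (U \<union> V \<union> W))"
    by (auto simp: S_def pendant_graph_def U_def V_def W_def)
  have P: "pos_edges S = (\<lambda>x. {z1, x}) ` insert z2 V \<union> (\<lambda>x. {z2, x}) ` W"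
    and N: "neg_edges S = (\<lambda>x. {z1, x}) ` U"
    by (auto simp: S_def pendant_graph_def U_def V_def W_def)
  have neg: "{f x + f y | x y. {x, y} \<in> neg_edges S} = (\<lambda>x. f z1 + x) ` f ` U"
    unfolding N image_image by (rule star_values) simp
  have "{\<bar>f x - f y\<bar> | x y. {x, y} \<in> pos_edges S}
      = {\<bar>f x - f y\<bar> | x y. {x, y} \<in> (\<lambda>x. {z1, x}) ` insert z2 V}
        \<union> {\<bar>f x - f y\<bar> | x y. {x, y} \<in> (\<lambda>x. {z2, x}) ` W}"
    unfolding P by blast
  also have "\<dots> = (\<lambda>y. \<bar>f z1 - f y\<bar>) ` insert z2 V \<union> (\<lambda>y. \<bar>f z2 - f y\<bar>) ` W"
    by (subst (1 2) star_values) (auto simp: abs_minus_commute)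
  finally have pos: "{\<bar>f x - f y\<bar> | x y. {x, y} \<in> pos_edges S}
      = insert \<bar>f z1 - f z2\<bar> ((\<lambda>y. \<bar>f z1 - y\<bar>) ` f ` V \<union> (\<lambda>y. \<bar>f z2 - y\<bar>) ` f ` W)"
    by (simp add: image_image)
  have ceil: "\<lceil>(real 2 + 1) / 2\<rceil> = 2" by (rule ceiling_unique) auto
  have two: "int 2 = 2" by simp
  have L: "?L \<longleftrightarrow> inj_on f (verts S) \<and> f ` verts S \<subseteq> {0..int m + 2} \<and>
      (\<lambda>x. f z1 + x) ` f ` U = {1..2} \<and>
      insert \<bar>f z1 - f z2\<bar> ((\<lambda>y. \<bar>f z1 - y\<bar>) ` f ` V \<union> (\<lambda>y. \<bar>f z2 - y\<bar>) ` f ` W) = {1..int m}"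
    (is "_ \<longleftrightarrow> ?M")
  proof
    assume ?L
    then obtain p' m' n' where *: "signed_graph S p' m' n'" "inj_on f (verts S)"
      "f ` verts S \<subseteq> {0..int m' + \<lceil>(real n' + 1) / 2\<rceil>}"
      "{f x + f y | x y. {x, y} \<in> neg_edges S} = {1..int n'}"
      "{\<bar>f x - f y\<bar> | x y. {x, y} \<in> pos_edges S} = {1..int m'}"
      unfolding additively_graceful_labeling_def S_def[symmetric]
      by (elim exE conjE) (rule that)
    have eq: "m' = m" "n' = 2" using *(1) sg by (auto simp: signed_graph_def)
    show ?M by (intro conjI *(2-5)[unfolded neg pos eq ceil two])
  next
    assume ?M
    then show ?L
      unfolding additively_graceful_labeling_def S_def[symmetric]
      by (intro exI[of _ "l + r + 4"] exI[of _ m] exI[of _ 2], unfold neg pos ceil two)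
        (use sg in argo)
  qed
  have finV: "finite (verts S)" and cardV: "card (verts S) = l + r + 4"
    using sg by (auto simp: signed_graph_def)
  have imV: "f ` verts S = insert (f z1) (f ` U \<union> insert (f z2) (f ` V \<union> f ` W))"
    unfolding Vs by blast
  have range: "{0..int m + 2} = insert 0 ({1, 2} \<union> {3..int m + 2})"
    by (auto simp: m_def)
  have R: "?R \<longleftrightarrow> f z1 = 0 \<and> f ` U = {1, 2} \<and> insert (f z2) (f ` V \<union> f ` W) = {3..int m + 2} \<and>
    insert (f z2) (f ` V \<union> (\<lambda>y. \<bar>f z2 - y\<bar>) ` f ` W) = {1..int m}"
    by (simp add: U_def V_def W_def m_def)
  have simplify_pos:
    "insert \<bar>f z1 - f z2\<bar> ((\<lambda>y. \<bar>f z1 - y\<bar>) ` f ` V \<union> (\<lambda>y. \<bar>f z2 - y\<bar>) ` f ` W)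
      = insert (f z2) (f ` V \<union> (\<lambda>y. \<bar>f z2 - y\<bar>) ` f ` W)"
    if "f z1 = 0" "\<And>x. x \<in> insert z2 V \<Longrightarrow> f x \<ge> 0"
  proof -
    have "(\<lambda>y. \<bar>f z1 - y\<bar>) ` f ` V = f ` V"
      unfolding image_image using that by (intro image_cong) auto
    moreover have "\<bar>f z1 - f z2\<bar> = f z2" using that by simp
    ultimately show ?thesis by simp
  qed
  show ?thesis
    unfolding L R
  proof
    assume M: ?M
    then have inj: "inj_on f (verts S)" by blast
    have nonneg: "f x \<ge> 0" if "x \<in> verts S" for x using M that by auto
    have z: "z1 \<notin> U" "z1 \<noteq> z2" "z1 \<notin> V" "z1 \<notin> W" "z2 \<notin> U" "U \<inter> V = {}" "U \<inter> W = {}"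
      using assms[unfolded named_vertices_distinct_iff, folded U_def V_def W_def] by blast+
    have "f z1 \<notin> f ` U"
      using inj z(1) unfolding Vs inj_on_def by blast
    then have z1: "f z1 = 0" and fU: "f ` U = {1, 2}"
      using negative_sums_determine_labels[of "f z1" "f ` U"] M nonneg by (auto simp: Vs)
    have "card (f ` verts S) = card {0..int m + 2}"
      using card_image[OF inj] cardV by (simp add: m_def)
    then have onto: "f ` verts S = {0..int m + 2}"
      using M by (intro card_subset_eq) auto
    have "{0, 1, 2} \<inter> insert (f z2) (f ` V \<union> f ` W) = f ` insert z1 U \<inter> f ` insert z2 (V \<union> W)"
      using z1 fU by auto
    also have "\<dots> = f ` (insert z1 U \<inter> insert z2 (V \<union> W))"
      by (rule inj_on_image_Int[OF inj, symmetric]) (auto simp: Vs)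
    also have "\<dots> = {}" using z by auto
    finally have dis: "{0, 1, 2} \<inter> insert (f z2) (f ` V \<union> f ` W) = {}" .
    have "{0, 1, 2} \<union> insert (f z2) (f ` V \<union> f ` W) = {0..int m + 2}"
      using onto[unfolded imV z1 fU] by (simp only: insert_is_Un[of 0 "{1, 2}"]
          insert_is_Un[of 0 "{1, 2} \<union> _"] Un_assoc)
    then have "insert (f z2) (f ` V \<union> f ` W) = {0..int m + 2} - {0, 1, 2}"
      using dis by (metis Diff_cancel Diff_triv Int_commute Un_Diff Un_empty_left)
    also have "\<dots> = {3..int m + 2}" by auto
    finally have "insert (f z2) (f ` V \<union> f ` W) = {3..int m + 2}" .
    moreover have "insert (f z2) (f ` V \<union> (\<lambda>y. \<bar>f z2 - y\<bar>) ` f ` W) = {1..int m}"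
    proof -
      have "f x \<ge> 0" if "x \<in> insert z2 V" for x
        using nonneg that by (auto simp: Vs)
      then show ?thesis
        using M simplify_pos[OF z1] by metis
    qed
    ultimately show "f z1 = 0 \<and> f ` U = {1, 2} \<and>
      insert (f z2) (f ` V \<union> f ` W) = {3..int m + 2} \<and>
      insert (f z2) (f ` V \<union> (\<lambda>y. \<bar>f z2 - y\<bar>) ` f ` W) = {1..int m}"
      using z1 fU by blast
  next
    assume A: "f z1 = 0 \<and> f ` U = {1, 2} \<and>
      insert (f z2) (f ` V \<union> f ` W) = {3..int m + 2} \<and>
      insert (f z2) (f ` V \<union> (\<lambda>y. \<bar>f z2 - y\<bar>) ` f ` W) = {1..int m}"
    then have onto: "f ` verts S = {0..int m + 2}"
      unfolding imV range by simp
    have inj: "inj_on f (verts S)"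
      by (rule eq_card_imp_inj_on[OF finV]) (simp add: onto cardV m_def)
    have "f x \<ge> 0" if "x \<in> insert z2 V" for x
    proof -
      have "f x \<in> f ` verts S" using that by (auto simp: Vs)
      then show ?thesis by (simp add: onto)
    qed
    then have "insert \<bar>f z1 - f z2\<bar> ((\<lambda>y. \<bar>f z1 - y\<bar>) ` f ` V \<union> (\<lambda>y. \<bar>f z2 - y\<bar>) ` f ` W)
        = {1..int m}"
      using A simplify_pos by metis
    moreover have "(\<lambda>x. f z1 + x) ` f ` U = {1..2}"
      using A by auto
    ultimately show ?M using inj onto by simp
  qed
qed

section \<open>Existence and uniqueness of the label sets\<close>

text \<open>For \<open>h = l / 2\<close> the interval \<open>{h+2..h+r-1}\<close> is symmetric about \<open>m / 2\<close>, and
  \<open>m + 1, m + 2\<close> lie at distance \<open>1, 2\<close> from the label \<open>m\<close> of \<open>z2\<close>. The labels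
  \<open>X\<close> of the \<open>v i\<close> are the remaining ones.\<close>

lemma label_sets_exist:
  fixes l r :: nat
  assumes "l \<ge> 2" "r \<ge> 2" "even l"
  defines "m \<equiv> int (l + r + 1)"
  obtains X Y :: "int set" where "finite X" "finite Y" "card X = l" "card Y = r"
    "insert m (X \<union> Y) = {3..m + 2}" "insert m (X \<union> (\<lambda>y. \<bar>m - y\<bar>) ` Y) = {1..m}"
proof -
  obtain h where l: "l = 2 * h" using assms by blast
  define k s where "k = int h" and "s = int r"
  have ks: "k \<ge> 1" "s \<ge> 2" "m = 2 * k + s + 1" using assms by (auto simp: k_def s_def m_def l)
  define X where "X = {3..k + 1} \<union> {k + s..m - 1}"
  define I where "I = {k + 2..k + s - 1}"
  define Y where "Y = I \<union> {m + 1, m + 2}"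
  have fin: "finite X" "finite Y" by (auto simp: X_def Y_def I_def)
  have "card X = card {3..k + 1} + card {k + s..m - 1}"
    unfolding X_def using ks by (intro card_Un_disjoint) auto
  then have cX: "card X = l" using ks by (simp add: k_def l)
  have "card Y = card I + card {m + 1, m + 2}"
    unfolding Y_def using ks by (intro card_Un_disjoint) (auto simp: I_def)
  then have cY: "card Y = r" using ks by (simp add: I_def s_def)
  have labels: "insert m (X \<union> Y) = {3..m + 2}"
    using ks by (auto simp: X_def Y_def I_def)
  have "(\<lambda>y. \<bar>m - y\<bar>) ` I = (\<lambda>y. m - y) ` I"
    using ks by (intro image_cong) (auto simp: I_def)
  also have "\<dots> = I"
    using ks by (simp add: I_def)
  finally have "(\<lambda>y. \<bar>m - y\<bar>) ` Y = I \<union> {1, 2}"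
    by (simp add: Y_def image_Un insert_commute)
  then have "insert m (X \<union> (\<lambda>y. \<bar>m - y\<bar>) ` Y) = {1..m}"
    using ks by (auto simp: X_def I_def)
  with fin cX cY labels show thesis by (rule that)
qed

text \<open>This is how the two set equations interact: labels above \<open>m\<close> cannot be values of edges at
  \<open>z1\<close>, and the values \<open>1, 2\<close> are not available as labels there.\<close>

lemma label_sets_constraints:
  fixes a m :: int
  assumes "insert a (X \<union> Y) = {3..m + 2}" "insert a (X \<union> (\<lambda>y. \<bar>a - y\<bar>) ` Y) = {1..m}"
    and "a \<notin> Y" "X \<inter> Y = {}" "m \<ge> 2"
  shows "a \<in> {3..m}" "m + 1 \<in> Y" "m + 2 \<in> Y" "{1, 2} \<union> (Y \<inter> {..m}) \<subseteq> (\<lambda>y. \<bar>a - y\<bar>) ` Y"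
proof -
  have aX: "insert a X \<subseteq> {3..m}"
  proof -
    have "insert a X \<subseteq> {3..m + 2} \<inter> {1..m}" using assms(1,2) by blast
    then show ?thesis by auto
  qed
  then show "a \<in> {3..m}" by blast
  have "m + 1 \<in> insert a (X \<union> Y)" "m + 2 \<in> insert a (X \<union> Y)"
    unfolding assms(1) using assms(5) by auto
  with aX show "m + 1 \<in> Y" "m + 2 \<in> Y" by auto
  show "{1, 2} \<union> (Y \<inter> {..m}) \<subseteq> (\<lambda>y. \<bar>a - y\<bar>) ` Y"
  proof
    fix t assume t: "t \<in> {1, 2} \<union> (Y \<inter> {..m})"
    have "Y \<subseteq> {3..m + 2}" using assms(1) by blast
    then have "t \<in> insert a (X \<union> (\<lambda>y. \<bar>a - y\<bar>) ` Y)"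
      unfolding assms(2) using t assms(5) by auto
    moreover have "t \<notin> insert a X"
      using t aX assms(3,4) by auto
    ultimately show "t \<in> (\<lambda>y. \<bar>a - y\<bar>) ` Y" by blast
  qed
qed

lemma label_sets_unique_2:
  fixes a m :: int
  assumes "insert a (X \<union> Y) = {3..m + 2}" "insert a (X \<union> (\<lambda>y. \<bar>a - y\<bar>) ` Y) = {1..m}"
    and "a \<notin> Y" "X \<inter> Y = {}" "m \<ge> 2" and "card Y = 2"
  shows "a = m \<and> Y = {m + 1, m + 2}"
proof -
  note c = label_sets_constraints[OF assms(1-5)]
  have "finite Y" using assms(6) card.infinite by fastforce
  then have Y: "{m + 1, m + 2} = Y"
    using c assms(6) by (intro card_subset_eq) auto
  have "1 \<in> (\<lambda>y. \<bar>a - y\<bar>) ` {m + 1, m + 2}" using c(4) Y by blast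
  then have "a = m" using c(1) by auto
  then show ?thesis using Y by simp
qed

text \<open>The third label \<open>x\<close> in \<open>Y\<close> together with \<open>1, 2\<close> has to be the set of the values
  \<open>\<bar>a - x\<bar>\<close>, \<open>m + 1 - a\<close> and \<open>m + 2 - a\<close>. The last two are consecutive, so either they are
  \<open>1, 2\<close>, giving \<open>a = m\<close> and \<open>m - x = x\<close>, or they are \<open>2, 3\<close>, giving \<open>x = 3\<close>, \<open>a = 4\<close> and
  \<open>m = 5\<close>. The bound on \<open>m\<close> excludes the second solution.\<close>

lemma label_sets_unique_3:
  fixes a m :: int
  assumes "insert a (X \<union> Y) = {3..m + 2}" "insert a (X \<union> (\<lambda>y. \<bar>a - y\<bar>) ` Y) = {1..m}"
    and "a \<notin> Y" "X \<inter> Y = {}" and "m \<ge> 6" and "card Y = 3"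
  shows "a = m \<and> Y = {m div 2, m + 1, m + 2}"
proof -
  have "m \<ge> 2" using assms(5) by simp
  note c = label_sets_constraints[OF assms(1-4) this]
  have fin: "finite Y" using assms(6) card.infinite by fastforce
  have "card (Y - {m + 1, m + 2}) = 1"
    using c assms(6) fin by (subst card_Diff_subset) auto
  then obtain x where x: "Y - {m + 1, m + 2} = {x}" by (rule card_1_singletonE)
  then have Y: "Y = {x, m + 1, m + 2}" using c by blast
  have "x \<in> {3..m + 2}" using assms(1) Y by blast
  moreover have "x \<notin> {m + 1, m + 2}" using x by blast
  ultimately have xm: "3 \<le> x" "x \<le> m" by auto
  have "(\<lambda>y. \<bar>a - y\<bar>) ` Y = {\<bar>a - x\<bar>, \<bar>a - (m + 1)\<bar>, \<bar>a - (m + 2)\<bar>}"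
    by (simp add: Y)
  with c(4) have vals: "t \<in> {\<bar>a - x\<bar>, \<bar>a - (m + 1)\<bar>, \<bar>a - (m + 2)\<bar>}"
    if "t \<in> {1, 2} \<union> (Y \<inter> {..m})" for t
    using that by blast
  have D: "1 \<in> {\<bar>a - x\<bar>, \<bar>a - (m + 1)\<bar>, \<bar>a - (m + 2)\<bar>}"
    "2 \<in> {\<bar>a - x\<bar>, \<bar>a - (m + 1)\<bar>, \<bar>a - (m + 2)\<bar>}"
    "x \<in> {\<bar>a - x\<bar>, \<bar>a - (m + 1)\<bar>, \<bar>a - (m + 2)\<bar>}"
    by (rule vals; use xm Y in simp)+
  have dist: "\<bar>a - (m + 1)\<bar> = m + 1 - a" "\<bar>a - (m + 2)\<bar> = m + 2 - a" "a \<le> m" "3 \<le> a"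
    using c(1) by auto
  have "a = m"
  proof (rule ccontr)
    \<comment> \<open>Then \<open>m + 1 - a \<ge> 2\<close>, so that only \<open>\<bar>a - x\<bar>\<close> can produce the value \<open>1\<close>.\<close>
    assume "a \<noteq> m"
    then have "\<bar>a - x\<bar> = 1" using D(1) dist by auto
    then have "a = m - 1" using D(2) dist \<open>a \<noteq> m\<close> by auto
    then have "x = 3" using D(3) dist xm \<open>\<bar>a - x\<bar> = 1\<close> by auto
    then show False using \<open>\<bar>a - x\<bar> = 1\<close> \<open>a = m - 1\<close> assms(5) by simp
  qed
  moreover from this have "m = 2 * x" using D(3) xm by auto
  ultimately have "a = m \<and> m = 2 * x" by simp
  then show ?thesis using Y by auto
qed

section \<open>Labelings of the pendant graph\<close>

lemma pendant_graph_graceful: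
  assumes dist: "named_vertices_distinct z1 z2 u v w l r"
    and lr: "l \<ge> 2" "r \<ge> 2" "even l"
  shows "additively_graceful (pendant_graph z1 z2 u v w l r)"
proof -
  define m where "m = int (l + r + 1)"
  obtain X Y :: "int set" where XY: "finite X" "finite Y" "card X = l" "card Y = r"
    "insert m (X \<union> Y) = {3..m + 2}" "insert m (X \<union> (\<lambda>y. \<bar>m - y\<bar>) ` Y) = {1..m}"
    unfolding m_def by (rule label_sets_exist[OF lr])
  define V W where "V = v ` {1..l}" and "W = w ` {1..r}"
  have U: "u ` {1..2::nat} = {u 1, u 2}"
  proof -
    have "{1..2::nat} = {1, 2}" by auto
    then show ?thesis by simp
  qed
  have d: "z1 \<noteq> z2" "inj_on v {1..l}" "inj_on w {1..r}"
     "{z1, z2} \<inter> ({u 1, u 2} \<union> V \<union> W) = {}" "{u 1, u 2} \<inter> (V \<union> W) = {}" "V \<inter> W = {}"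
    using dist[unfolded named_vertices_distinct_iff, folded V_def W_def, unfolded U] by argo+
  have "inj_on u {1..2}"
    using dist[unfolded named_vertices_distinct_iff] by argo
  then have u12: "u 1 \<noteq> u 2" by (simp add: inj_on_eq_iff)
  have "card V = l" "card W = r" "finite V" "finite W"
    using d by (auto simp: V_def W_def card_image)
  then obtain \<phi> \<psi> where \<phi>: "bij_betw \<phi> V X" and \<psi>: "bij_betw \<psi> W Y"
    using finite_same_card_bij[of V X] finite_same_card_bij[of W Y] XY by auto
  define f where "f = (\<lambda>x. if x = z1 then 0 else if x = z2 then m else if x = u 1 then 1
    else if x = u 2 then 2 else if x \<in> V then \<phi> x else \<psi> x)"
  have f: "f z1 = 0" "f z2 = m" "f ` {u 1, u 2} = {1, 2}"
    using d u12 by (auto simp: f_def)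
  have "f ` V = \<phi> ` V" using d by (intro image_cong) (auto simp: f_def)
  then have fV: "f ` V = X" using \<phi> by (simp add: bij_betw_def)
  have "f ` W = \<psi> ` W" using d by (intro image_cong) (auto simp: f_def)
  then have fW: "f ` W = Y" using \<psi> by (simp add: bij_betw_def)
  have "additively_graceful_labeling (pendant_graph z1 z2 u v w l r) f"
    unfolding graceful_iff_label_sets[OF dist] V_def[symmetric] W_def[symmetric]
      m_def[symmetric] U
    unfolding f fV fW using XY by simp
  then show ?thesis by (auto simp: additively_graceful_def)
qed

lemma graceful_labelings_agree:
  assumes dist: "named_vertices_distinct z1 z2 u v w l r"
    and r: "r = 2 \<or> r = 3" and l: "l \<ge> 2"
    and f: "additively_graceful_labeling (pendant_graph z1 z2 u v w l r) f"
    and g: "additively_graceful_labeling (pendant_graph z1 z2 u v w l r) g"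
  shows "equal_up_to_rearrangement z1 z2 u v w l r f g"
proof -
  define m where "m = int (l + r + 1)"
  define V W where "V = v ` {1..l}" and "W = w ` {1..r}"
  have d: "inj_on u {1..2}" "inj_on v {1..l}" "inj_on w {1..r}"
      "z2 \<notin> V" "z2 \<notin> W" "V \<inter> W = {}"
    using dist[unfolded named_vertices_distinct_iff, folded V_def W_def] by blast+
  have verts: "verts (pendant_graph z1 z2 u v w l r) = {z1, z2} \<union> u ` {1..2} \<union> V \<union> W"
    by (simp add: pendant_graph_def V_def W_def)
  have labels: "h z1 = 0 \<and> h ` u ` {1..2} = {1, 2} \<and> h z2 = m \<and>
      h ` W = (if r = 2 then {m + 1, m + 2} else {m div 2, m + 1, m + 2}) \<and>
      h ` V = {3..m + 2} - insert (h z2) (h ` W) \<and>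
      inj_on (h \<circ> u) {1..2} \<and> inj_on (h \<circ> v) {1..l} \<and> inj_on (h \<circ> w) {1..r}"
    if h: "additively_graceful_labeling (pendant_graph z1 z2 u v w l r) h" for h
  proof -
    have inj: "inj_on h ({z1, z2} \<union> u ` {1..2} \<union> V \<union> W)"
      using h unfolding additively_graceful_labeling_def verts by blast
    have injs: "inj_on (h \<circ> u) {1..2}" "inj_on (h \<circ> v) {1..l}" "inj_on (h \<circ> w) {1..r}"
      using d inj by (auto intro!: comp_inj_on elim: inj_on_subset simp: V_def W_def)
    note sets = h[unfolded graceful_iff_label_sets[OF dist], folded V_def W_def m_def]
    have nin: "h z2 \<notin> h ` V" "h z2 \<notin> h ` W" "h ` V \<inter> h ` W = {}"
      using inj d(4-6) unfolding inj_on_def by blast+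
    have cardY: "card (h ` W) = r"
      using card_image[OF injs(3)] by (simp add: W_def image_comp)
    have eqs: "insert (h z2) (h ` V \<union> h ` W) = {3..m + 2}"
        "insert (h z2) (h ` V \<union> (\<lambda>y. \<bar>h z2 - y\<bar>) ` h ` W) = {1..m}"
      using sets by blast+
    have "h z2 = m \<and>
        h ` W = (if r = 2 then {m + 1, m + 2} else {m div 2, m + 1, m + 2})"
    proof (cases "r = 2")
      case True
      have "m \<ge> 2" using l by (simp add: m_def)
      then show ?thesis
        using label_sets_unique_2[OF eqs nin(2,3)] cardY True by simp
    next
      case False
      then have "r = 3" using r by simp
      moreover from this have "m \<ge> 6" using l by (simp add: m_def)
      ultimately show ?thesis
        using label_sets_unique_3[OF eqs nin(2,3)] cardY by simp
    qed
    moreover have "h ` V = {3..m + 2} - insert (h z2) (h ` W)"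
      using eqs(1) nin by blast
    ultimately show ?thesis using sets injs by blast
  qed
  note F = labels[OF f] and G = labels[OF g]
  have z: "g z1 = f z1" "g z2 = f z2" using F G by simp_all
  have "f ` u ` {1..2} = g ` u ` {1..2}" "f ` V = g ` V" "f ` W = g ` W"
    using F G by simp_all
  then have im: "(f \<circ> u) ` {1..2} = (g \<circ> u) ` {1..2}" "(f \<circ> v) ` {1..l} = (g \<circ> v) ` {1..l}"
      "(f \<circ> w) ` {1..r} = (g \<circ> w) ` {1..r}"
    by (simp_all only: V_def W_def image_comp)
  have "inj_on (f \<circ> u) {1..2}" "inj_on (g \<circ> u) {1..2}"
    using F G by blast+
  then obtain \<alpha> where "\<alpha> permutes {1..2}" "\<forall>i\<in>{1..2}. g (u i) = f (u (\<alpha> i))"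
    using same_image_imp_permuted[OF _ _ im(1)] unfolding o_def by blast
  moreover have "inj_on (f \<circ> v) {1..l}" "inj_on (g \<circ> v) {1..l}"
    using F G by blast+
  then obtain \<beta> where "\<beta> permutes {1..l}" "\<forall>i\<in>{1..l}. g (v i) = f (v (\<beta> i))"
    using same_image_imp_permuted[OF _ _ im(2)] unfolding o_def by blast
  moreover have "inj_on (f \<circ> w) {1..r}" "inj_on (g \<circ> w) {1..r}"
    using F G by blast+
  then obtain \<gamma> where "\<gamma> permutes {1..r}" "\<forall>i\<in>{1..r}. g (w i) = f (w (\<gamma> i))"
    using same_image_imp_permuted[OF _ _ im(3)] unfolding o_def by blast
  ultimately show ?thesis
    unfolding equal_up_to_rearrangement_def using z by blast
qed

theorem theorem4p10:
  fixes z1 z2 :: 'a and u v w :: "nat \<Rightarrow> 'a" and l r :: nat and S :: "'a signed_graph"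
  assumes "named_vertices_distinct z1 z2 u v w l r"
    and "S = pendant_graph z1 z2 u v w l r"
  shows "(l \<ge> 2 \<and> r \<ge> 2 \<and> even l \<longrightarrow> additively_graceful S) \<and>
    ((r = 2 \<or> r = 3) \<and> l \<ge> 2 \<and> even l \<longrightarrow>
      (\<exists>f. additively_graceful_labeling S f \<and>
        (\<forall>g. additively_graceful_labeling S g \<longrightarrow>
          equal_up_to_rearrangement z1 z2 u v w l r f g)))"
proof -
  have graceful: "additively_graceful S" if "l \<ge> 2" "r \<ge> 2" "even l"
    unfolding assms(2) by (rule pendant_graph_graceful[OF assms(1) that])
  moreover have "\<exists>f. additively_graceful_labeling S f \<and>
      (\<forall>g. additively_graceful_labeling S g \<longrightarrow> equal_up_to_rearrangement z1 z2 u v w l r f g)"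
    if "r = 2 \<or> r = 3" "l \<ge> 2" "even l"
  proof -
    have "additively_graceful S" using graceful that by auto
    then obtain f where "additively_graceful_labeling S f"
      by (auto simp: additively_graceful_def)
    then show ?thesis
      using graceful_labelings_agree[OF assms(1) that(1,2)] unfolding assms(2) by blast
  qed
  ultimately show ?thesis by blast
qed

end
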